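(* Let $F_h=L_h+R_h$ and let $(x_{h,k})_{k\in\mathbb N}$, $(y_{h,k})_{k\in\mathbb N}$ be generated by the IML FISTA iteration described in the context, with the Type $i$ approximation of the proximity operator, $i\in\{1,2\}$. Suppose that: (1) $t_{h,k+1}=\left(\frac{k+a}{a}\right)^d$ for all $k\in\mathbb N^*$, with $d\in(0,1]$ and $a>\max\{1,(2d)^{1/d}\}$; (2) $\nabla L_h$ is $\beta_h$-Lipschitz and $\nabla L_H$ is $\beta_H$-Lipschitz, at most $p$ coarse corrections are computed over the whole run, and the step sizes at the fine and coarse levels $\tau_h,\tau_H\in(0,+\infty)$ satisfy $\tau_h<\beta_h^{-1}$ and $\tau_H<\beta_H^{-1}$; (3) $\sum_{k=1}^{+\infty}k^d\sqrt{\epsilon_{h,k}}<+\infty$ in the case of Type $1$ approximation ($i=1$), and $\sum_{k=1}^{+\infty}k^{2d}\epsilon_{h,k}<+\infty$ in the case of Type $2$ approximation ($i=2$). Then: - the sequence $\left(k^{2d}\left(F_h(x_{h,k})-F_h(x^* )\right)\right)_{k\in\mathbb N}$ belongs to $\ell_\infty(\mathbb N)$, where $x^*$ is a minimizer of $F_h$; - the sequence $(x_{h,k})_{k\in\mathbb N}$ converges to a minimizer of $F_h$.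
   Context: Fine level: $L_h,R_h:\mathbb R^{N_h}\to(-\infty,+\infty]$ are convex, lower semicontinuous and proper; $L_h$ is differentiable with $\beta_h$-Lipschitz gradient; $F_h=L_h+R_h$ is coercive. Coarse level: $N_H<N_h$; $L_H,R_H:\mathbb R^{N_H}\to(-\infty,+\infty]$ are lower-dimensional approximations of $L_h,R_h$, in the same class (convex, l.s.c., proper), with $L_H$ differentiable with $\beta_H$-Lipschitz gradient. $I_h^H:\mathbb R^{N_h}\to\mathbb R^{N_H}$ and $I_H^h:\mathbb R^{N_H}\to\mathbb R^{N_h}$ are linear operators with $I_H^h=\nu (I_h^H)^T$ for some $\nu>0$. Smoothing: for a convex, l.s.c., proper $R$ and $\gamma>0$, a convex continuously differentiable function $R_\gamma$ is a smoothed convex approximation of $R$ if there are finite scalars $\eta_1,\eta_2$ with $\eta_1+\eta_2>0$ and $R(y)-\eta_1\gamma\le R_\gamma(y)\le R(y)+\eta_2\gamma$ for all $y$. Let $R_{h,\gamma_h}$, $R_{H,\gamma_H}$ be such approximations of $R_h$, $R_H$ ($\gamma_h,\gamma_H>0$). Coarse model at iteration $k$: $F_H=L_H+R_{H,\gamma_H}+\langle v_{H,k},\cdot\rangle$ with $v_{H,k}=I_h^H(\nabla L_h(y_{h,k})+\nabla R_{h,\gamma_h}(y_{h,k}))-(\nabla L_H(I_h^Hy_{h,k})+\nabla R_{H,\gamma_H}(I_h^Hy_{h,k}))$. Coarse iterations: $m>0$ is an integer and the operators $\Phi_{H,\ell}$ on $\mathbb R^{N_H}$ (they may implicitly depend on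 $k$, and use step size $\tau_H$) are such that, with $s_{H,k,0}=I_h^Hy_{h,k}$ and $s_{H,k,m}=\Phi_{H,m-1}\circ\cdots\circ\Phi_{H,0}(s_{H,k,0})$, one has $F_H(s_{H,k,m})\le F_H(s_{H,k,0})$, and $s_{H,k,m}-s_{H,k,0}$ is bounded. IML FISTA iteration: start from $x_{h,0},y_{h,0}\in\mathbb R^{N_h}$, $t_{h,0}=1$. For $k=0,1,\dots$: either (coarse correction; done at most $p$ times over the whole run) choose $\bar\tau_{h,k}>0$ and set $\bar y_{h,k}=y_{h,k}+\bar\tau_{h,k}I_H^h(s_{H,k,m}-s_{H,k,0})$, or set $\bar y_{h,k}=y_{h,k}$. Then take $x_{h,k+1}\approx_{i,\epsilon_{h,k}}\mathrm{prox}_{\tau_hR_h}(\bar y_{h,k}-\tau_h\nabla L_h(\bar y_{h,k}))$, set $t_{h,k+1}=\left(\frac{k+a}{a}\right)^d$, $\alpha_{h,k}=\frac{t_{h,k}-1}{t_{h,k+1}}$, and $y_{h,k+1}=x_{h,k+1}+\alpha_{h,k}(x_{h,k+1}-x_{h,k})$. Approximations: $\mathrm{prox}_{\gamma R}(y)=\arg\min_x R(x)+\frac1{2\gamma}\|x-y\|^2$. For $\epsilon\ge0$, the $\epsilon$-subdifferential of $R$ at $z\in\mathrm{dom}\,R$ is $\partial_\epsilon R(z)=\{y\in\mathbb R^N:\ R(x)\ge R(z)+\langle x-z,y\rangle-\epsilon\ \ \forall x\in\mathbb R^N\}$. For $\gamma>0$: Type 1: $z\approx_{1,\epsilon}\mathrm{prox}_{\gamma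 R}(y)$ iff $0$ belongs to the $\epsilon$-subdifferential at $z$ of the function $R+\frac1{2\gamma}\|\cdot-y\|^2$. Type 2: $z\approx_{2,\epsilon}\mathrm{prox}_{\gamma R}(y)$ iff $\gamma^{-1}(y-z)\in\partial_\epsilon R(z)$. *)

theory Defs
  imports "HOL-Analysis.Analysis"
begin

text \<open>Functions with values in the extended half-line above minus infinity are rendered as
  \<^typ>\<open>ereal\<close>-valued functions that are proper in the following sense.\<close>

definition effective_domain :: "('a \<Rightarrow> ereal) \<Rightarrow> 'a set"
  where "effective_domain R = {x. R x < \<infinity>}"

definition proper_fun :: "('a \<Rightarrow> ereal) \<Rightarrow> bool"
  where "proper_fun R \<longleftrightarrow> (\<forall>x. R x \<noteq> -\<infinity>) \<and> effective_domain R \<noteq> {}"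

text \<open>The convention \<^prop>\<open>0 * \<infinity> = (0 :: ereal)\<close> makes the endpoint cases
  of the convexity inequality trivial.\<close>

definition convex_fun :: "('a::real_vector \<Rightarrow> ereal) \<Rightarrow> bool"
  where "convex_fun R \<longleftrightarrow>
    (\<forall>x y. \<forall>u\<ge>0. \<forall>v\<ge>0. u + v = 1 \<longrightarrow>
      R (u *\<^sub>R x + v *\<^sub>R y) \<le> ereal u * R x + ereal v * R y)"

definition lsc_fun :: "('a::topological_space \<Rightarrow> ereal) \<Rightarrow> bool"
  where "lsc_fun R \<longleftrightarrow> (\<forall>x. R x \<le> Liminf (at x) R)"

definition coercive_fun :: "('a::real_normed_vector \<Rightarrow> ereal) \<Rightarrow> bool"
  where "coercive_fun F \<longleftrightarrow> (F \<longlongrightarrow> \<infinity>) at_infinity"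

text \<open>Unspecified where the function is not differentiable.\<close>

definition gradient :: "('a::real_inner \<Rightarrow> real) \<Rightarrow> 'a \<Rightarrow> 'a"
  where "gradient f x = (THE g. GDERIV f x :> g)"

text \<open>The smoothed function is real-valued and the bounds are required at every point, so
  the existence of a smoothed approximation forces \<open>R\<close> to be finite everywhere.\<close>

definition smoothed_convex_approx ::
    "('a::real_inner \<Rightarrow> ereal) \<Rightarrow> real \<Rightarrow> ('a \<Rightarrow> real) \<Rightarrow> bool"
  where "smoothed_convex_approx R \<gamma> R\<gamma> \<longleftrightarrow>
    convex_on UNIV R\<gamma> \<and>
    (\<forall>y. R\<gamma> differentiable (at y)) \<and> continuous_on UNIV (gradient R\<gamma>) \<and>
    (\<exists>\<eta>\<^sub>1 \<eta>\<^sub>2 :: real. \<eta>\<^sub>1 + \<eta>\<^sub>2 > 0 \<and>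
      (\<forall>y. R y - ereal (\<eta>\<^sub>1 * \<gamma>) \<le> ereal (R\<gamma> y) \<and>
           ereal (R\<gamma> y) \<le> R y + ereal (\<eta>\<^sub>2 * \<gamma>)))"

text \<open>The \<open>\<epsilon>\<close>-subdifferential is empty outside the effective domain.\<close>

definition eps_subdiff :: "real \<Rightarrow> ('a::real_inner \<Rightarrow> ereal) \<Rightarrow> 'a \<Rightarrow> 'a set"
  where "eps_subdiff \<epsilon> R z =
    {y. z \<in> effective_domain R \<and> (\<forall>x. R x \<ge> R z + ereal (inner (x - z) y) - ereal \<epsilon>)}"

datatype approx_type = Type1 | Type2

text \<open>\<open>prox_approx i \<epsilon> \<gamma> R y z\<close>: the point \<open>z\<close> is a Type \<open>i\<close> approximation, with accuracy
  \<open>\<epsilon>\<close>, of the minimizer of \<open>R + \<parallel>\<cdot> - y\<parallel>\<^sup>2 / (2\<gamma>)\<close>.\<close>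

fun prox_approx ::
    "approx_type \<Rightarrow> real \<Rightarrow> real \<Rightarrow> ('a::real_inner \<Rightarrow> ereal) \<Rightarrow> 'a \<Rightarrow> 'a \<Rightarrow> bool"
  where
    "prox_approx Type1 \<epsilon> \<gamma> R y z \<longleftrightarrow>
      0 \<in> eps_subdiff \<epsilon> (\<lambda>x. R x + ereal (1 / (2 * \<gamma>) * (norm (x - y))\<^sup>2)) z"
  | "prox_approx Type2 \<epsilon> \<gamma> R y z \<longleftrightarrow> inverse \<gamma> *\<^sub>R (y - z) \<in> eps_subdiff \<epsilon> R z"

text \<open>First-order coherence term and coarse model attached to the fine iterate \<open>y\<close>;
  \<open>P\<close> is the restriction operator, and \<open>R\<^sub>h\<gamma>\<close>, \<open>R\<^sub>H\<gamma>\<close> are the smoothed functions.\<close>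

definition coherence_vec ::
    "('a::real_inner \<Rightarrow> 'b::real_inner) \<Rightarrow> ('a \<Rightarrow> real) \<Rightarrow> ('a \<Rightarrow> real) \<Rightarrow>
     ('b \<Rightarrow> real) \<Rightarrow> ('b \<Rightarrow> real) \<Rightarrow> 'a \<Rightarrow> 'b"
  where "coherence_vec P L\<^sub>h R\<^sub>h\<gamma> L\<^sub>H R\<^sub>H\<gamma> y =
    P (gradient L\<^sub>h y + gradient R\<^sub>h\<gamma> y) - (gradient L\<^sub>H (P y) + gradient R\<^sub>H\<gamma> (P y))"

definition coarse_model ::
    "('a::real_inner \<Rightarrow> 'b::real_inner) \<Rightarrow> ('a \<Rightarrow> real) \<Rightarrow> ('a \<Rightarrow> real) \<Rightarrow>
     ('b \<Rightarrow> real) \<Rightarrow> ('b \<Rightarrow> real) \<Rightarrow> 'a \<Rightarrow> 'b \<Rightarrow> real"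
  where "coarse_model P L\<^sub>h R\<^sub>h\<gamma> L\<^sub>H R\<^sub>H\<gamma> y s =
    L\<^sub>H s + R\<^sub>H\<gamma> s + inner (coherence_vec P L\<^sub>h R\<^sub>h\<gamma> L\<^sub>H R\<^sub>H\<gamma> y) s"

text \<open>Membership in \<open>\<ell>\<^sub>\<infinity>\<close> for an extended-real sequence; in particular all terms are finite.\<close>

definition in_ell_infinity :: "(nat \<Rightarrow> ereal) \<Rightarrow> bool"
  where "in_ell_infinity u \<longleftrightarrow> (\<exists>B::real. \<forall>k. \<bar>u k\<bar> \<le> ereal B)"

end

theory Submission
  imports Defs
begin

text \<open>Only finitely many coarse corrections are computed, so from some index on the iteration is
  FISTA with inexact proximal steps, whatever the corrections did before. A smoothed
  approximation makes \<open>R\<^sub>h\<close> finite everywhere, so that \<open>F\<^sub>h\<close> is real-valued and continuous.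
  A Type 1 error \<open>\<epsilon>\<close> moves the iterate by at most \<open>sqrt (2 * \<tau> * \<epsilon>)\<close> from the exact proximal
  point, so both types give the same perturbed descent inequality. From it, with
  \<open>u k = x k + t k * (x (k + 1) - x k)\<close>, the energy
  \<open>(t k)\<^sup>2 * (F (x (k + 1)) - F z) + (norm (u k - z))\<^sup>2 / (2 * \<tau>)\<close> is bounded and
  \<open>t (k + 1) * (F (x (k + 1)) - F z)\<close> is summable. The same argument then gives the summability of
  \<open>t k * (norm (x (k + 1) - x k))\<^sup>2\<close>, whence the distance of \<open>x k\<close> to every minimizer
  converges, and Opial's argument yields the convergence of \<open>x\<close>.\<close>


section \<open>Energy recursions with summable perturbations\<close>

text \<open>A discrete Gronwall argument for errors that scale with the square root of the new
  energy. Up to an index where the running maximum \<open>M\<close> is attained, telescoping gives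
  \<open>M <= A + suminf c * sqrt M\<close>. Young's inequality absorbs half of \<open>M\<close> on
  the left, which is where \<open>K\<close> comes from.\<close>

lemma perturbed_decrease:
  fixes E r b c :: "nat \<Rightarrow> real"
  assumes nonneg: "\<And>k. E k \<ge> 0" "\<And>k. r k \<ge> 0" "\<And>k. b k \<ge> 0" "\<And>k. c k \<ge> 0"
    and summable: "summable b" "summable c"
    and step: "\<And>k. E (Suc k) + r k \<le> E k + b k + c k * sqrt (E (Suc k))"
  shows "\<exists>B. \<forall>k. E k \<le> B" and "summable r"
proof -
  define A where "A = E 0 + suminf b"
  have unroll: "E n + (\<Sum>k<n. r k) \<le> A + suminf c * sqrt M"
    if M: "\<And>k. k \<le> n \<Longrightarrow> E k \<le> M" for n M
  proof -
    have "E j + (\<Sum>k<j. r k) \<le> E 0 + (\<Sum>k<j. b k) + (\<Sum>k<j. c k) * sqrt M" if "j \<le> n" for j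
      using that
    proof (induction j)
      case (Suc j)
      have "c j * sqrt (E (Suc j)) \<le> c j * sqrt M"
        using M[OF Suc.prems] nonneg by (intro mult_left_mono) auto
      then show ?case using Suc step[of j] by (auto simp: algebra_simps)
    qed simp
    from this[of n] have "E n + (\<Sum>k<n. r k) \<le> E 0 + (\<Sum>k<n. b k) + (\<Sum>k<n. c k) * sqrt M" by simp
    also have "\<dots> \<le> A + suminf c * sqrt M"
    proof -
      have "0 \<le> M" using M[of 0] nonneg(1)[of 0] by simp
      then show ?thesis unfolding A_def
        by (intro add_mono mult_right_mono sum_le_suminf) (use nonneg summable in auto)
    qed
    finally show ?thesis .
  qed
  define K where "K = 2 * A + (suminf c)\<^sup>2"
  have bound: "E n \<le> K" for n
  proof -
    define M where "M = Max (E ` {..n})"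
    have M: "E k \<le> M" if "k \<le> n" for k using that unfolding M_def by auto
    have "M \<in> E ` {..n}" unfolding M_def by (intro Max_in) auto
    \<comment> \<open>Unrolling only up to the index \<open>j\<close> of the maximum bounds
      \<open>M\<close> by an expression in \<open>M\<close> itself.\<close>
    then obtain j where j: "j \<le> n" "M = E j" by auto
    have "M \<le> A + suminf c * sqrt M"
      using unroll[of j M] M j sum_nonneg[of "{..<j}" r] nonneg by fastforce
    also have "suminf c * sqrt M \<le> ((suminf c)\<^sup>2 + (sqrt M)\<^sup>2) / 2"
      using sum_squares_bound[of "suminf c" "sqrt M"] by simp
    also have "(sqrt M)\<^sup>2 = M" using j nonneg by simp
    finally have "M \<le> K" unfolding K_def by (simp add: field_simps)
    then show ?thesis using M[of n] by simp
  qed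
  then show "\<exists>B. \<forall>k. E k \<le> B" by blast
  have "(\<Sum>k<n. norm (r k)) \<le> A + suminf c * sqrt K" for n
    using unroll[of n K] bound nonneg by (simp add: add_increasing order_trans[rotated])
  then show "summable r"
    by (intro summableI_nonneg_bounded[of r]) (use nonneg in auto)
qed

section \<open>Inexact forward-backward steps\<close>

text \<open>This justifies the definite description in \<open>gradient\<close>:
  \<open>adjoint f' 1\<close> is the Riesz representative of the derivative, and derivatives are
  unique.\<close>

lemma gderiv_gradient:
  fixes f :: "'a::euclidean_space \<Rightarrow> real"
  assumes "f differentiable (at x)"
  shows "GDERIV f x :> gradient f x"
proof -
  from assms obtain f' where f': "(f has_derivative f') (at x)" unfolding differentiable_def by blast
  then interpret bounded_linear f' by (rule has_derivative_bounded_linear)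
  have "f' = (\<lambda>h. inner h (adjoint f' 1))"
    using adjoint_works[OF linear_axioms, of _ 1] by (auto simp: inner_commute)
  then have "GDERIV f x :> adjoint f' 1" using f' unfolding gderiv_def by simp
  moreover have "u = v" if "GDERIV f x :> u" "GDERIV f x :> v" for u v
    using has_derivative_unique[OF that[unfolded gderiv_def]] by (metis vector_eq_rdot inner_commute)
  ultimately show ?thesis unfolding gradient_def by (intro theI[of "\<lambda>g. GDERIV f x :> g"]) blast+
qed

lemma line_derivative:
  fixes f :: "'a::euclidean_space \<Rightarrow> real"
  assumes "\<And>z. f differentiable (at z)"
  shows "((\<lambda>s. f (y + s *\<^sub>R h)) has_real_derivative inner h (gradient f (y + s *\<^sub>R h))) (at s)"
proof -
  have "(f has_derivative (\<lambda>v. inner v (gradient f (y + s *\<^sub>R h)))) (at (y + s *\<^sub>R h))"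
    using gderiv_gradient[OF assms] unfolding gderiv_def .
  moreover have "((\<lambda>s. y + s *\<^sub>R h) has_derivative (\<lambda>s. s *\<^sub>R h)) (at s)"
    by (auto intro!: derivative_eq_intros)
  ultimately have "((\<lambda>s. f (y + s *\<^sub>R h)) has_derivative (\<lambda>v. inner (v *\<^sub>R h) (gradient f (y + s *\<^sub>R h)))) (at s)"
    by (rule has_derivative_compose[rotated])
  then show ?thesis unfolding has_field_derivative_def by (simp add: mult.commute[of _ "inner _ _"])
qed

text \<open>Restricting \<open>f\<close> to the line through \<open>y\<close> and \<open>z\<close>
  reduces this to the tangent inequality in one variable.\<close>

lemma convex_gradient_inequality:
  fixes f :: "'a::euclidean_space \<Rightarrow> real"
  assumes "convex_on UNIV f" "\<And>z. f differentiable (at z)"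
  shows "f y + inner (z - y) (gradient f y) \<le> f z"
proof -
  have "convex_on UNIV (\<lambda>s::real. f (y + s *\<^sub>R (z - y)))"
  proof (intro convex_onI)
    fix t r s :: real assume "0 < t" "t < 1"
    moreover have "y + ((1 - t) *\<^sub>R r + t *\<^sub>R s) *\<^sub>R (z - y)
        = (1 - t) *\<^sub>R (y + r *\<^sub>R (z - y)) + t *\<^sub>R (y + s *\<^sub>R (z - y))"
      by (simp add: algebra_simps)
    ultimately show "f (y + ((1 - t) *\<^sub>R r + t *\<^sub>R s) *\<^sub>R (z - y))
        \<le> (1 - t) * f (y + r *\<^sub>R (z - y)) + t * f (y + s *\<^sub>R (z - y))"
      using convex_onD[OF assms(1), of t] by simp
  qed simp
  from convex_on_imp_above_tangent[OF this _ _ _ line_derivative[OF assms(2), of y "z - y" 0], of 1]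
  show ?thesis by simp
qed

lemma lipschitz_gradient_upper_bound:
  fixes f :: "'a::euclidean_space \<Rightarrow> real"
  assumes diff: "\<And>z. f differentiable (at z)" and lip: "\<beta>-lipschitz_on UNIV (gradient f)"
  shows "f z \<le> f y + inner (z - y) (gradient f y) + \<beta> / 2 * (norm (z - y))\<^sup>2"
proof -
  define h where "h = z - y"
  \<comment> \<open>\<psi> is \<open>f\<close> along the segment minus its quadratic upper model.
    Cauchy-Schwarz and the Lipschitz bound make its derivative nonpositive.\<close>
  define \<psi> where "\<psi> s = f (y + s *\<^sub>R h) - s * inner h (gradient f y) - \<beta> / 2 * s\<^sup>2 * (norm h)\<^sup>2" for s :: real
  have "\<psi> 1 \<le> \<psi> 0"
  proof (rule DERIV_nonpos_imp_nonincreasing[of 0 1 \<psi>])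
    fix s :: real assume "0 \<le> s" "s \<le> 1"
    let ?D = "inner h (gradient f (y + s *\<^sub>R h)) - inner h (gradient f y) - \<beta> * s * (norm h)\<^sup>2"
    have "(\<psi> has_real_derivative ?D) (at s)"
      unfolding \<psi>_def by (auto intro!: derivative_eq_intros line_derivative[OF diff])
    moreover have "?D \<le> 0"
    proof -
      have "inner h (gradient f (y + s *\<^sub>R h) - gradient f y)
          \<le> norm h * norm (gradient f (y + s *\<^sub>R h) - gradient f y)"
        by (rule norm_cauchy_schwarz)
      also have "norm (gradient f (y + s *\<^sub>R h) - gradient f y) \<le> \<beta> * norm (s *\<^sub>R h)"
        using lipschitz_onD[OF lip, of "y + s *\<^sub>R h" y] by (simp add: dist_norm)
      then have "norm h * norm (gradient f (y + s *\<^sub>R h) - gradient f y) \<le> norm h * (\<beta> * norm (s *\<^sub>R h))"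
        by (intro mult_left_mono) auto
      finally show ?thesis using \<open>0 \<le> s\<close> by (simp add: inner_diff_right power2_eq_square algebra_simps)
    qed
    ultimately show "\<exists>D. (\<psi> has_real_derivative D) (at s) \<and> D \<le> 0" by blast
  qed simp
  then show ?thesis by (simp add: \<psi>_def h_def)
qed

section \<open>Exact and approximate proximal points\<close>

lemma norm_add_scaleR_squared:
  "(norm (u + l *\<^sub>R v))\<^sup>2 = (norm u)\<^sup>2 + 2 * l * inner v u + l\<^sup>2 * (norm v)\<^sup>2"
  for u v :: "'a::real_inner"
  unfolding power2_norm_eq_inner
  by (simp add: inner_add_left inner_add_right inner_commute power2_eq_square)

text \<open>First-order optimality: compare \<open>p\<close> with a point slightly moved towards
  \<open>z\<close>, divide by the displacement \<open>l\<close>, and let \<open>l\<close> tend to 0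
  from the right.\<close>

lemma prox_minimizer_subgradient:
  fixes g :: "'a::real_inner \<Rightarrow> real"
  assumes g: "convex_on UNIV g" and \<tau>: "\<tau> > 0"
    and min: "\<And>z. g p + (norm (p - w))\<^sup>2 / (2 * \<tau>) \<le> g z + (norm (z - w))\<^sup>2 / (2 * \<tau>)"
  shows "g p + inner (z - p) (w - p) / \<tau> \<le> g z"
proof -
  have ineq: "g p + inner (z - p) (w - p) / \<tau> - l * ((norm (z - p))\<^sup>2 / (2 * \<tau>)) \<le> g z" if l: "0 < l" "l < 1" for l :: real
  proof -
    let ?v = "(1 - l) *\<^sub>R p + l *\<^sub>R z"
    have "g ?v \<le> (1 - l) * g p + l * g z" using convex_onD[OF g, of l p z] l by simp
    moreover have "g p + (norm (p - w))\<^sup>2 / (2 * \<tau>) \<le> g ?v + (norm (?v - w))\<^sup>2 / (2 * \<tau>)" by (rule min)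
    moreover have "(norm (?v - w))\<^sup>2 = (norm (p - w))\<^sup>2 - 2 * l * inner (z - p) (w - p) + l\<^sup>2 * (norm (z - p))\<^sup>2"
    proof -
      have "?v - w = (p - w) + l *\<^sub>R (z - p)" by (simp add: algebra_simps)
      then show ?thesis unfolding norm_add_scaleR_squared[of "p - w" l "z - p", folded \<open>?v - w = _\<close>]
        by (simp add: inner_diff_right algebra_simps)
    qed
    then have "(norm (?v - w))\<^sup>2 / (2 * \<tau>)
        = (norm (p - w))\<^sup>2 / (2 * \<tau>) - l * (inner (z - p) (w - p) / \<tau>) + l * (l * ((norm (z - p))\<^sup>2 / (2 * \<tau>)))"
      by (simp add: add_divide_distrib diff_divide_distrib power2_eq_square)
    ultimately have "g p \<le> g p - l * g p + l * g z - l * (inner (z - p) (w - p) / \<tau>) + l * (l * ((norm (z - p))\<^sup>2 / (2 * \<tau>)))"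
      by (simp add: left_diff_distrib)
    then have "l * (g p + inner (z - p) (w - p) / \<tau> - l * ((norm (z - p))\<^sup>2 / (2 * \<tau>))) \<le> l * g z"
      by (simp add: distrib_left right_diff_distrib)
    then show ?thesis using l by simp
  qed
  have "((\<lambda>l. g p + inner (z - p) (w - p) / \<tau> - l * ((norm (z - p))\<^sup>2 / (2 * \<tau>)))
      \<longlongrightarrow> g p + inner (z - p) (w - p) / \<tau> - 0 * ((norm (z - p))\<^sup>2 / (2 * \<tau>))) (at_right 0)"
    by (intro tendsto_intros)
  moreover have "\<forall>\<^sub>F l in at_right 0. g p + inner (z - p) (w - p) / \<tau> - l * ((norm (z - p))\<^sup>2 / (2 * \<tau>)) \<le> g z"
    using eventually_at_right_real[OF zero_less_one] by eventually_elim (use ineq in auto)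
  ultimately show ?thesis by (auto dest: tendsto_upperbound)
qed

text \<open>The approximate minimizer \<open>x\<close> localizes the search: by strong convexity of
  the proximal objective, every point at least as good as \<open>x\<close> lies in a fixed ball
  around it, and compactness gives a minimizer there.\<close>

lemma prox_minimizer_exists:
  fixes g :: "'a::euclidean_space \<Rightarrow> real"
  assumes g: "convex_on UNIV g" and \<tau>: "\<tau> > 0"
    and approx: "\<And>z. g x + (norm (x - w))\<^sup>2 / (2 * \<tau>) \<le> g z + (norm (z - w))\<^sup>2 / (2 * \<tau>) + \<epsilon>"
  obtains p where "\<And>z. g p + (norm (p - w))\<^sup>2 / (2 * \<tau>) \<le> g z + (norm (z - w))\<^sup>2 / (2 * \<tau>)"
proof -
  define h where "h z = g z + (norm (z - w))\<^sup>2 / (2 * \<tau>)" for z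
  have eps: "\<epsilon> \<ge> 0" using approx[of x] by simp
  have cont: "continuous_on UNIV g" using g by (intro convex_on_continuous) auto
  have ball: "z \<in> cball x (sqrt (8 * \<tau> * \<epsilon>))" if "h z \<le> h x" for z
  proof -
    \<comment> \<open>At the midpoint \<open>v\<close> the objective lies at least \<open>D\<close>
      below the average of its values at \<open>x\<close> and \<open>z\<close>, but by at most
      \<epsilon> below its value at \<open>x\<close>; hence \<open>D\<close> is at most \<epsilon>
      and the radius is \<open>sqrt (8 * \<tau> * \<epsilon>)\<close>.\<close>
    define v where "v = (1 - 1/2) *\<^sub>R x + (1/2) *\<^sub>R z"
    define X where "X = (norm (x - w))\<^sup>2 / (2 * \<tau>)"
    define Z where "Z = (norm (z - w))\<^sup>2 / (2 * \<tau>)"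
    define D where "D = (norm (z - x))\<^sup>2 / (8 * \<tau>)"
    have "g v \<le> (1 - 1/2) * g x + (1/2) * g z" unfolding v_def using convex_onD[OF g, of "1/2" x z] by simp
    moreover have "h x \<le> h v + \<epsilon>" using approx[of v] unfolding h_def by simp
    moreover have "(norm (v - w))\<^sup>2 = (norm (x - w))\<^sup>2 / 2 + (norm (z - w))\<^sup>2 / 2 - (norm (z - x))\<^sup>2 / 4"
    proof -
      have 1: "v - w = (x - w) + (1/2) *\<^sub>R (z - x)"
        unfolding v_def by (simp only: scaleR_left_diff_distrib scaleR_right_diff_distrib scaleR_one) simp
      have 2: "z - w = (x - w) + 1 *\<^sub>R (z - x)" by simp
      show ?thesis
        unfolding 1 unfolding 2 norm_add_scaleR_squared by (simp add: power_divide field_simps)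
    qed
    then have "(norm (v - w))\<^sup>2 / (2 * \<tau>) = X / 2 + Z / 2 - D"
      unfolding X_def Z_def D_def by (simp add: add_divide_distrib diff_divide_distrib)
    ultimately have "D \<le> \<epsilon>" using that unfolding h_def X_def[symmetric] Z_def[symmetric] by simp
    then have "(norm (z - x))\<^sup>2 \<le> 8 * \<tau> * \<epsilon>" using \<tau> unfolding D_def by (simp add: field_simps)
    then show ?thesis by (simp add: dist_norm norm_minus_commute real_le_rsqrt)
  qed
  have "continuous_on (cball x (sqrt (8 * \<tau> * \<epsilon>))) h"
    unfolding h_def using \<tau> by (intro continuous_intros continuous_on_subset[OF cont]) auto
  moreover have "cball x (sqrt (8 * \<tau> * \<epsilon>)) \<noteq> {}" using ball[of x] by blast
  ultimately obtain p where p: "\<And>z. z \<in> cball x (sqrt (8 * \<tau> * \<epsilon>)) \<Longrightarrow> h p \<le> h z"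
    using continuous_attains_inf[OF compact_cball] by meson
  have "h p \<le> h z" for z
    using p[of x] p[of z] ball[of z] eps \<tau> by (cases "h z \<le> h x") auto
  then show thesis using that unfolding h_def by blast
qed

text \<open>The witness is \<open>e = x - p\<close> with \<open>p\<close> the exact proximal point,
  so that \<open>w - x + e = w - p\<close> is the exact subgradient direction at \<open>p\<close>.
  Seen from \<open>x\<close> it is an \<epsilon>-subgradient; the term
  \<open>(norm e)\<^sup>2\<close> left over by the identity has the favourable sign and is
  dropped.\<close>

lemma Type1_prox_subgradient:
  fixes g :: "'a::euclidean_space \<Rightarrow> real"
  assumes g: "convex_on UNIV g" and \<tau>: "\<tau> > 0"
    and approx: "\<And>z. g x + (norm (x - w))\<^sup>2 / (2 * \<tau>) \<le> g z + (norm (z - w))\<^sup>2 / (2 * \<tau>) + \<epsilon>"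
  obtains e where "norm e \<le> sqrt (2 * \<tau> * \<epsilon>)"
    and "\<And>z. g x + inner (z - x) (w - x + e) / \<tau> - \<epsilon> \<le> g z"
proof -
  obtain p where min: "\<And>z. g p + (norm (p - w))\<^sup>2 / (2 * \<tau>) \<le> g z + (norm (z - w))\<^sup>2 / (2 * \<tau>)"
    using prox_minimizer_exists[OF g \<tau>, of x w \<epsilon>] approx by blast
  have sub: "g p + inner (z - p) (w - p) / \<tau> \<le> g z" for z
    using prox_minimizer_subgradient[OF g \<tau> min] .
  let ?e = "x - p"
  have "(norm ?e)\<^sup>2 \<le> 2 * \<tau> * \<epsilon>"
  proof -
    have "(norm ?e)\<^sup>2 = (norm (x - w))\<^sup>2 - (norm (p - w))\<^sup>2 + 2 * inner (x - p) (w - p)"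
      by (simp add: power2_norm_eq_inner algebra_simps inner_commute)
    then have "(norm ?e)\<^sup>2 / (2 * \<tau>) = (norm (x - w))\<^sup>2 / (2 * \<tau>) - (norm (p - w))\<^sup>2 / (2 * \<tau>) + inner (x - p) (w - p) / \<tau>"
      by (simp add: add_divide_distrib diff_divide_distrib)
    then have "(norm ?e)\<^sup>2 / (2 * \<tau>) \<le> \<epsilon>" using sub[of x] approx[of p] by linarith
    then show ?thesis using \<tau> by (simp add: field_simps)
  qed
  then have "norm ?e \<le> sqrt (2 * \<tau> * \<epsilon>)" by (simp add: real_le_rsqrt)
  moreover have "g x + inner (z - x) (w - x + ?e) / \<tau> - \<epsilon> \<le> g z" for z
  proof -
    have "2 * inner (z - x) (w - x + ?e) + (norm ?e)\<^sup>2 = (norm (x - w))\<^sup>2 - (norm (p - w))\<^sup>2 + 2 * inner (z - p) (w - p)"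
      by (simp add: power2_norm_eq_inner algebra_simps inner_commute)
    then have "2 * inner (z - x) (w - x + ?e) \<le> (norm (x - w))\<^sup>2 - (norm (p - w))\<^sup>2 + 2 * inner (z - p) (w - p)"
      by (smt (verit) zero_le_power2)
    then have "2 * inner (z - x) (w - x + ?e) / (2 * \<tau>)
        \<le> ((norm (x - w))\<^sup>2 - (norm (p - w))\<^sup>2 + 2 * inner (z - p) (w - p)) / (2 * \<tau>)"
      using \<tau> by (intro divide_right_mono) auto
    then have "inner (z - x) (w - x + ?e) / \<tau>
        \<le> (norm (x - w))\<^sup>2 / (2 * \<tau>) - (norm (p - w))\<^sup>2 / (2 * \<tau>) + inner (z - p) (w - p) / \<tau>"
      by (simp add: add_divide_distrib diff_divide_distrib)
    then show ?thesis using sub[of z] approx[of p] by linarith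
  qed
  ultimately show thesis by (rule that)
qed

text \<open>Adds the quadratic upper bound of \<open>f\<close> at \<open>y\<close>, the gradient
  inequality at \<open>y\<close> and the approximate subgradient inequality of \<open>g\<close>.
  Expanding the inner product by the three-point identity cancels the terms in \<open>x - y\<close>,
  the step size condition having replaced \<beta> by \<open>inverse \<tau>\<close>.\<close>

lemma forward_backward_descent:
  fixes f g :: "'a::euclidean_space \<Rightarrow> real"
  assumes f: "convex_on UNIV f" "\<And>z. f differentiable (at z)" "\<beta>-lipschitz_on UNIV (gradient f)"
    and \<tau>: "\<tau> > 0" "\<beta> \<le> inverse \<tau>"
    and sub: "\<And>z. g x + inner (z - x) (y - \<tau> *\<^sub>R gradient f y - x + e) / \<tau> - \<epsilon> \<le> g z"
  shows "f x + g x + (norm (x - z))\<^sup>2 / (2 * \<tau>)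
    \<le> f z + g z + (norm (y - z))\<^sup>2 / (2 * \<tau>) + \<epsilon> + inner (x - z) e / \<tau>"
proof -
  have "f x \<le> f y + inner (x - y) (gradient f y) + \<beta> / 2 * (norm (x - y))\<^sup>2"
    by (rule lipschitz_gradient_upper_bound[OF f(2,3)])
  also have "\<beta> / 2 * (norm (x - y))\<^sup>2 \<le> inverse \<tau> / 2 * (norm (x - y))\<^sup>2"
    using \<tau> by (intro mult_right_mono) auto
  also have "inverse \<tau> / 2 * (norm (x - y))\<^sup>2 = (norm (x - y))\<^sup>2 / (2 * \<tau>)" by (simp add: field_simps)
  finally have "f x \<le> f y + inner (x - y) (gradient f y) + (norm (x - y))\<^sup>2 / (2 * \<tau>)" by simp
  moreover have "f y + inner (z - y) (gradient f y) \<le> f z"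
    by (rule convex_gradient_inequality[OF f(1,2)])
  moreover have "inner (z - x) (y - \<tau> *\<^sub>R gradient f y - x + e) / \<tau>
      = (norm (x - z))\<^sup>2 / (2 * \<tau>) + (norm (x - y))\<^sup>2 / (2 * \<tau>) - (norm (y - z))\<^sup>2 / (2 * \<tau>)
        - inner (z - x) (gradient f y) - inner (x - z) e / \<tau>"
  proof -
    have "2 * inner (z - x) (y - x) = (norm (x - z))\<^sup>2 + (norm (x - y))\<^sup>2 - (norm (y - z))\<^sup>2"
      by (simp add: power2_norm_eq_inner inner_commute inner_diff_left inner_diff_right)
    then have "2 * inner (z - x) (y - x) / (2 * \<tau>) = (norm (x - z))\<^sup>2 / (2 * \<tau>) + (norm (x - y))\<^sup>2 / (2 * \<tau>) - (norm (y - z))\<^sup>2 / (2 * \<tau>)"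
      by (simp only: add_divide_distrib diff_divide_distrib)
    moreover have "inner (z - x) (y - \<tau> *\<^sub>R gradient f y - x + e)
        = inner (z - x) (y - x) - \<tau> * inner (z - x) (gradient f y) - inner (x - z) e"
      by (simp add: inner_diff_left inner_diff_right inner_add_right)
    ultimately show ?thesis using \<tau>(1) by (simp add: add_divide_distrib diff_divide_distrib)
  qed
  moreover have "inner (z - x) (gradient f y) = inner (z - y) (gradient f y) - inner (x - y) (gradient f y)"
    by (simp add: inner_diff_left)
  ultimately show ?thesis using sub[of z] by linarith
qed

section \<open>Inexact accelerated iterations\<close>

lemma quasi_decreasing_convergent:
  fixes \<phi> \<theta> :: "nat \<Rightarrow> real"
  assumes "\<And>k. \<phi> k \<ge> 0" "\<And>k. \<theta> k \<ge> 0" "summable \<theta>" "\<And>k. \<phi> (Suc k) \<le> \<phi> k + \<theta> k"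
  shows "convergent \<phi>"
proof -
  define \<psi> where "\<psi> k = \<phi> k - (\<Sum>j<k. \<theta> j)" for k
  have "decseq \<psi>"
    unfolding decseq_Suc_iff \<psi>_def using assms(4) by (simp add: algebra_simps)
  moreover have "- suminf \<theta> \<le> \<psi> k" for k
    unfolding \<psi>_def using assms(1)[of k] sum_le_suminf[OF assms(3), of "{..<k}"] assms(2) by simp
  ultimately obtain L where "\<psi> \<longlonglongrightarrow> L" by (blast intro: decseq_convergent)
  then have "(\<lambda>k. \<psi> k + (\<Sum>j<k. \<theta> j)) \<longlonglongrightarrow> L + suminf \<theta>"
    by (intro tendsto_intros summable_LIMSEQ assms(3))
  then show ?thesis unfolding \<psi>_def convergent_def by auto
qed

text \<open>Puts the error term of the descent inequality into the square-root form that
  \<open>perturbed_decrease\<close> accepts.\<close>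

lemma inner_error_bound:
  assumes "\<tau> > 0" "norm e \<le> \<sigma>" "(norm v)\<^sup>2 / (2 * \<tau>) \<le> E"
  shows "inner v e / \<tau> \<le> sqrt (2 * \<tau>) / \<tau> * \<sigma> * sqrt E"
proof -
  have "norm v \<le> sqrt (2 * \<tau> * E)" using assms by (intro real_le_rsqrt) (simp add: field_simps)
  then have "norm v \<le> sqrt (2 * \<tau>) * sqrt E" by (simp add: real_sqrt_mult)
  then have "norm v * norm e \<le> sqrt (2 * \<tau>) * sqrt E * \<sigma>"
    using assms by (intro mult_mono) (auto intro: order_trans[OF norm_ge_zero])
  then have "inner v e \<le> sqrt (2 * \<tau>) * sqrt E * \<sigma>"
    using norm_cauchy_schwarz[of v e] by linarith
  then show ?thesis using assms(1) by (simp add: field_simps)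
qed

lemma continuous_bounded_sublevels_attains_min:
  fixes F :: "'a::heine_borel \<Rightarrow> real"
  assumes cont: "continuous_on UNIV F" and sub: "\<And>B. bounded {v. F v \<le> B}"
  obtains z where "\<And>v. F z \<le> F v"
proof -
  \<comment> \<open>Here \<open>undefined\<close> merely serves as some point of the space, which
    makes the sublevel set nonempty.\<close>
  define S where "S = {v. F v \<le> F undefined}"
  have "closed S" unfolding S_def using cont by (intro closed_Collect_le continuous_intros) auto
  then have "compact S" using sub unfolding S_def by (simp add: compact_eq_bounded_closed)
  moreover have "undefined \<in> S" unfolding S_def by simp
  ultimately obtain z where "z \<in> S" "\<And>v. v \<in> S \<Longrightarrow> F z \<le> F v"
    using continuous_attains_inf[of S F] continuous_on_subset[OF cont] by blast
  then have "F z \<le> F v" for v unfolding S_def by (cases "F v \<le> F undefined") fastforce+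
  then show thesis by (rule that)
qed

text \<open>\<open>y k\<close> denotes the extrapolated point from which \<open>x (k + 2)\<close> is computed, and \<open>\<epsilon> k\<close>,
  \<open>e k\<close> are the errors made there.\<close>

locale inexact_fista =
  fixes F :: "'a::euclidean_space \<Rightarrow> real" and x y e :: "nat \<Rightarrow> 'a"
    and T \<epsilon> \<sigma> :: "nat \<Rightarrow> real" and \<tau> c :: real
  assumes \<tau>_pos: "\<tau> > 0"
    and F_convex: "convex_on UNIV F"
    and F_sublevel: "\<And>B. bounded {v. F v \<le> B}"
    and T_ge_1: "\<And>k. T k \<ge> 1"
    and T_mono: "\<And>k. T k \<le> T (Suc k)"
    and c_pos: "c > 0"
    and T_growth: "\<And>k. (T (Suc k))\<^sup>2 - T (Suc k) + c * T (Suc k) \<le> (T k)\<^sup>2"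
    and y_eq: "\<And>k. y k = x (Suc k) + ((T k - 1) / T (Suc k)) *\<^sub>R (x (Suc k) - x k)"
    and descent: "\<And>k v. F (x (Suc (Suc k))) + (norm (x (Suc (Suc k)) - v))\<^sup>2 / (2 * \<tau>)
      \<le> F v + (norm (y k - v))\<^sup>2 / (2 * \<tau>) + \<epsilon> k + inner (x (Suc (Suc k)) - v) (e k) / \<tau>"
    and \<epsilon>_nonneg: "\<And>k. \<epsilon> k \<ge> 0"
    and e_bound: "\<And>k. norm (e k) \<le> \<sigma> k"
    and \<epsilon>_summable: "summable (\<lambda>k. (T (Suc k))\<^sup>2 * \<epsilon> k)"
    and \<sigma>_summable: "summable (\<lambda>k. T (Suc k) * \<sigma> k)"
begin

lemma T_nonneg: "T k \<ge> 0" and T_pos: "T k > 0"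
  using T_ge_1[of k] by auto

lemma \<sigma>_nonneg: "\<sigma> k \<ge> 0"
  using e_bound[of k] norm_ge_zero order_trans by blast

lemma F_continuous: "continuous_on UNIV F"
  using F_convex by (intro convex_on_continuous) auto

text \<open>The usual FISTA auxiliary point. With \<open>t = T (Suc k)\<close> and \<open>v\<close>
  the convex combination of \<open>x (Suc k)\<close> and \<open>z\<close> with weight
  \<open>1 / t\<close> on \<open>z\<close>, both \<open>t *\<^sub>R (y k - v) = u k - z\<close> and
  \<open>t *\<^sub>R (x (Suc (Suc k)) - v) = u (Suc k) - z\<close> hold, so the norm terms telescope
  after scaling by \<open>t\<^sup>2\<close>.\<close>

definition u :: "nat \<Rightarrow> 'a" where "u k = x k + T k *\<^sub>R (x (Suc k) - x k)"

definition step_energy :: "nat \<Rightarrow> real" where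
  "step_energy k = (norm (x (Suc k) - x k))\<^sup>2 / (2 * \<tau>)"

definition energy :: "'a \<Rightarrow> nat \<Rightarrow> real" where
  "energy z k = (T k)\<^sup>2 * (F (x (Suc k)) - F z) + (norm (u k - z))\<^sup>2 / (2 * \<tau>)"

lemma summable_errors:
  "summable (\<lambda>k. sqrt (2 * \<tau>) / \<tau> * (T (Suc k) * \<sigma> k))"
  by (intro summable_mult \<sigma>_summable)

text \<open>This is the descent inequality at the convex combination of \<open>x (k + 1)\<close> and \<open>z\<close> with
  weight \<open>1 / T (k + 1)\<close> on \<open>z\<close>.\<close>

lemma energy_step:
  assumes min: "\<And>v. F z \<le> F v"
  shows "energy z (Suc k) + c * T (Suc k) * (F (x (Suc k)) - F z)
    \<le> energy z k + (T (Suc k))\<^sup>2 * \<epsilon> k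
      + sqrt (2 * \<tau>) / \<tau> * (T (Suc k) * \<sigma> k) * sqrt (energy z (Suc k))"
proof -
  define t where "t = T (Suc k)"
  have t: "t > 0" "t \<ge> 1" unfolding t_def using T_pos T_ge_1 by auto
  define v where "v = (1 - 1 / t) *\<^sub>R x (Suc k) + (1 / t) *\<^sub>R z"
  define w where "w = F (x (Suc k)) - F z"
  define w' where "w' = F (x (Suc (Suc k))) - F z"
  define N where "N = (norm (u k - z))\<^sup>2 / (2 * \<tau>)"
  define N' where "N' = (norm (u (Suc k) - z))\<^sup>2 / (2 * \<tau>)"
  define I where "I = inner (u (Suc k) - z) (e k) / \<tau>"
  have v1: "x (Suc (Suc k)) - v = (1 / t) *\<^sub>R (u (Suc k) - z)"
    unfolding v_def u_def t_def[symmetric] using t by (simp add: algebra_simps)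
  define \<alpha> where "\<alpha> = (T k - 1) / t"
  have "t *\<^sub>R (y k - v) = (t * \<alpha>) *\<^sub>R (x (Suc k) - x k) + (x (Suc k) - z)"
    unfolding v_def y_eq t_def[symmetric] \<alpha>_def[symmetric] using t by (simp add: algebra_simps)
  also have "t * \<alpha> = T k - 1" unfolding \<alpha>_def using t by simp
  finally have "t *\<^sub>R (y k - v) = u k - z" unfolding u_def by (simp add: algebra_simps)
  then have v2: "y k - v = (1 / t) *\<^sub>R (u k - z)"
    using t by (metis divide_self_if less_irrefl scaleR_one scaleR_scaleR times_divide_eq_left mult_1)
  have "F v \<le> (1 - 1 / t) * F (x (Suc k)) + (1 / t) * F z"
    unfolding v_def using convex_onD[OF F_convex, of "1 / t" "x (Suc k)" z] t by simp
  moreover have "(norm (y k - v))\<^sup>2 / (2 * \<tau>) = N / t\<^sup>2" "(norm (x (Suc (Suc k)) - v))\<^sup>2 / (2 * \<tau>) = N' / t\<^sup>2"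
    "inner (x (Suc (Suc k)) - v) (e k) / \<tau> = I / t"
    unfolding v1 v2 N_def N'_def I_def using t by (simp_all add: power_mult_distrib power_divide mult_ac)
  ultimately have "w' + N' / t\<^sup>2 \<le> (1 - 1 / t) * w + N / t\<^sup>2 + \<epsilon> k + I / t"
    using descent[of k v] unfolding w_def w'_def by (simp add: left_diff_distrib right_diff_distrib)
  then have "t\<^sup>2 * (w' + N' / t\<^sup>2) \<le> t\<^sup>2 * ((1 - 1 / t) * w + N / t\<^sup>2 + \<epsilon> k + I / t)"
    using t by (intro mult_left_mono) auto
  moreover have "t\<^sup>2 * (w' + N' / t\<^sup>2) = t\<^sup>2 * w' + N'" using t by (simp add: distrib_left)
  moreover have "t\<^sup>2 * ((1 - 1 / t) * w + N / t\<^sup>2 + \<epsilon> k + I / t) = (t\<^sup>2 - t) * w + N + t\<^sup>2 * \<epsilon> k + t * I"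
    using t by (simp add: distrib_left left_diff_distrib right_diff_distrib power2_eq_square)
  \<comment> \<open>The objective gap \<open>w\<close> is nonnegative, so \<open>T_growth\<close>
    can be multiplied by it. The margin \<open>c\<close> in the growth condition produces the
    summable term on the left.\<close>
  moreover have "(t\<^sup>2 - t + c * t) * w \<le> (T k)\<^sup>2 * w"
    unfolding t_def by (intro mult_right_mono T_growth) (simp add: w_def min)
  ultimately have "t\<^sup>2 * w' + N' + c * t * w \<le> (T k)\<^sup>2 * w + N + t\<^sup>2 * \<epsilon> k + t * I"
    by (simp add: distrib_right)
  \<comment> \<open>At a minimizer the objective part of the energy is nonnegative, so the energy
    dominates its norm part.\<close>
  moreover have "I \<le> sqrt (2 * \<tau>) / \<tau> * \<sigma> k * sqrt (energy z (Suc k))"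
    unfolding I_def by (intro inner_error_bound \<tau>_pos e_bound) (simp add: energy_def min)
  then have "t * I \<le> t * (sqrt (2 * \<tau>) / \<tau> * \<sigma> k * sqrt (energy z (Suc k)))"
    using t by (intro mult_left_mono) auto
  ultimately show ?thesis
    unfolding energy_def t_def[symmetric] w_def w'_def N_def N'_def by (simp add: mult_ac)
qed

lemma energy_bounds:
  assumes min: "\<And>v. F z \<le> F v"
  shows "\<exists>B. \<forall>k. energy z k \<le> B" and "summable (\<lambda>k. T (Suc k) * (F (x (Suc k)) - F z))"
proof -
  have E: "energy z k \<ge> 0" for k unfolding energy_def using min \<tau>_pos by simp
  have r: "c * T (Suc k) * (F (x (Suc k)) - F z) \<ge> 0" for k using c_pos T_nonneg min by simp
  have b: "(T (Suc k))\<^sup>2 * \<epsilon> k \<ge> 0" for k using \<epsilon>_nonneg by simp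
  have s: "sqrt (2 * \<tau>) / \<tau> * (T (Suc k) * \<sigma> k) \<ge> 0" for k using \<tau>_pos T_nonneg \<sigma>_nonneg by simp
  note * = perturbed_decrease[where E = "energy z", OF E r b s \<epsilon>_summable summable_errors energy_step[OF min]]
  show "\<exists>B. \<forall>k. energy z k \<le> B" using *(1) .
  show "summable (\<lambda>k. T (Suc k) * (F (x (Suc k)) - F z))"
    using summable_mult[OF *(2), of "1 / c"] c_pos by (simp add: mult.assoc)
qed

lemma objective_rate:
  assumes min: "\<And>v. F z \<le> F v"
  obtains B where "\<And>k. (T k)\<^sup>2 * (F (x (Suc k)) - F z) \<le> B"
proof -
  obtain B where "\<And>k. energy z k \<le> B" using energy_bounds(1)[OF min] by blast
  moreover have "(T k)\<^sup>2 * (F (x (Suc k)) - F z) \<le> energy z k" for k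
    unfolding energy_def using \<tau>_pos by simp
  ultimately show thesis using that order_trans by meson
qed

text \<open>This is the descent inequality at \<open>x (k + 1)\<close>.\<close>

lemma step_energy_step:
  assumes min: "\<And>v. F z \<le> F v"
  defines "G \<equiv> \<lambda>k. (T k)\<^sup>2 * (F (x (Suc k)) - F z + step_energy k)"
  shows "G (Suc k) + T k * step_energy k
    \<le> G k + (T (Suc k) * (F (x (Suc k)) - F z) + (T (Suc k))\<^sup>2 * \<epsilon> k)
      + sqrt (2 * \<tau>) / \<tau> * (T (Suc k) * \<sigma> k) * sqrt (G (Suc k))"
proof -
  define t where "t = T (Suc k)"
  have t: "t > 0" unfolding t_def using T_pos by auto
  define w where "w = F (x (Suc k)) - F z"
  define w' where "w' = F (x (Suc (Suc k))) - F z"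
  define s where "s = step_energy k"
  define s' where "s' = step_energy (Suc k)"
  define v where "v = t *\<^sub>R (x (Suc (Suc k)) - x (Suc k))"
  define I where "I = inner v (e k) / \<tau>"
  have s0: "s \<ge> 0" "s' \<ge> 0" unfolding s_def s'_def step_energy_def using \<tau>_pos by auto
  have "(norm (y k - x (Suc k)))\<^sup>2 / (2 * \<tau>) = (T k - 1)\<^sup>2 / t\<^sup>2 * s"
    unfolding y_eq s_def step_energy_def t_def by (simp add: power_mult_distrib power_divide)
  moreover have "inner (x (Suc (Suc k)) - x (Suc k)) (e k) / \<tau> = I / t"
    unfolding I_def v_def using t by simp
  ultimately have "w' + s' \<le> w + (T k - 1)\<^sup>2 / t\<^sup>2 * s + \<epsilon> k + I / t"
    using descent[of k "x (Suc k)"] unfolding w_def w'_def s'_def step_energy_def by simp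
  then have "t\<^sup>2 * (w' + s') \<le> t\<^sup>2 * (w + (T k - 1)\<^sup>2 / t\<^sup>2 * s + \<epsilon> k + I / t)"
    using t by (intro mult_left_mono) auto
  also have "\<dots> = t\<^sup>2 * w + (T k - 1)\<^sup>2 * s + t\<^sup>2 * \<epsilon> k + t * I"
    using t by (simp add: distrib_left power2_eq_square)
  finally have "t\<^sup>2 * (w' + s') \<le> t\<^sup>2 * w + (T k - 1)\<^sup>2 * s + t\<^sup>2 * \<epsilon> k + t * I" .
  \<comment> \<open>Here the growth condition is used without its margin; the excess
    \<open>t * w\<close> becomes a perturbation, summable by \<open>energy_bounds\<close>.\<close>
  moreover have "t\<^sup>2 * w \<le> ((T k)\<^sup>2 + t) * w"
  proof -
    have "c * t \<ge> 0" using c_pos t by simp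
    then have "t\<^sup>2 \<le> (T k)\<^sup>2 + t" using T_growth[of k] unfolding t_def by linarith
    then show ?thesis by (intro mult_right_mono) (simp_all add: w_def min)
  qed
  \<comment> \<open>The inertial factor \<open>(T k - 1)\<^sup>2\<close> falls short of
    \<open>(T k)\<^sup>2\<close> by at least \<open>T k\<close>; this gap is the dissipation of the
    step energy.\<close>
  moreover have "(T k - 1)\<^sup>2 * s \<le> ((T k)\<^sup>2 - T k) * s"
    using T_ge_1[of k] by (intro mult_right_mono s0) (simp add: power2_eq_square algebra_simps)
  moreover have "I \<le> sqrt (2 * \<tau>) / \<tau> * \<sigma> k * sqrt (t\<^sup>2 * (w' + s'))"
    unfolding I_def
  proof (intro inner_error_bound \<tau>_pos e_bound)
    have "(norm v)\<^sup>2 / (2 * \<tau>) = t\<^sup>2 * s'"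
      unfolding v_def s'_def step_energy_def by (simp add: power_mult_distrib)
    also have "\<dots> \<le> t\<^sup>2 * (w' + s')" by (intro mult_left_mono) (simp_all add: w'_def min)
    finally show "(norm v)\<^sup>2 / (2 * \<tau>) \<le> t\<^sup>2 * (w' + s')" .
  qed
  then have "t * I \<le> t * (sqrt (2 * \<tau>) / \<tau> * \<sigma> k * sqrt (t\<^sup>2 * (w' + s')))"
    using t by (intro mult_left_mono) auto
  ultimately have "t\<^sup>2 * (w' + s') + T k * s \<le> (T k)\<^sup>2 * (w + s) + (t * w + t\<^sup>2 * \<epsilon> k)
      + t * (sqrt (2 * \<tau>) / \<tau> * \<sigma> k * sqrt (t\<^sup>2 * (w' + s')))"
    by (simp add: distrib_left distrib_right left_diff_distrib)
  then show ?thesis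
    unfolding G_def t_def[symmetric] w_def w'_def s_def s'_def by (simp add: mult_ac)
qed

lemma summable_steps:
  assumes min: "\<And>v. F z \<le> F v"
  shows "summable (\<lambda>k. T k * (norm (x (Suc k) - x k))\<^sup>2)"
proof -
  have st: "step_energy k \<ge> 0" for k unfolding step_energy_def using \<tau>_pos by simp
  have E: "(T k)\<^sup>2 * (F (x (Suc k)) - F z + step_energy k) \<ge> 0" for k using st min by simp
  have r: "T k * step_energy k \<ge> 0" for k using T_nonneg st by simp
  have b: "T (Suc k) * (F (x (Suc k)) - F z) + (T (Suc k))\<^sup>2 * \<epsilon> k \<ge> 0" for k
    using \<epsilon>_nonneg T_nonneg min by simp
  have s: "sqrt (2 * \<tau>) / \<tau> * (T (Suc k) * \<sigma> k) \<ge> 0" for k using \<tau>_pos T_nonneg \<sigma>_nonneg by simp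
  have "summable (\<lambda>k. T k * step_energy k)"
    by (rule perturbed_decrease(2)[where E = "\<lambda>k. (T k)\<^sup>2 * (F (x (Suc k)) - F z + step_energy k)",
          OF E r b s summable_add[OF energy_bounds(2)[OF min] \<epsilon>_summable] summable_errors step_energy_step[OF min]])
  from summable_mult[OF this, of "2 * \<tau>"] show ?thesis
    unfolding step_energy_def using \<tau>_pos by (simp add: field_simps)
qed

section \<open>Convergence of the iterates\<close>

lemma iterates_bounded:
  assumes min: "\<And>v. F z \<le> F v"
  shows "bounded (range (\<lambda>k. x (Suc k)))"
proof -
  obtain B where B: "\<And>k. (T k)\<^sup>2 * (F (x (Suc k)) - F z) \<le> B" using objective_rate[OF min] by blast
  have "F (x (Suc k)) - F z \<le> (T k)\<^sup>2 * (F (x (Suc k)) - F z)" for k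
    using T_ge_1[of k] min[of "x (Suc k)"] by (intro mult_le_cancel_right1[THEN iffD2]) (auto simp: one_le_power)
  then have "F (x (Suc k)) \<le> F z + B" for k using B[of k] by (smt (verit))
  then show ?thesis by (intro bounded_subset[OF F_sublevel[of "F z + B"]]) auto
qed

text \<open>The descent inequality at the minimizer \<open>z\<close>, with the objective gap
  dropped, controls the positive part \<theta> of the increments of the squared distance. Scaling by
  \<open>T (Suc k)\<close> turns the inertial coefficient into \<open>T k - 1\<close>, so
  \<open>T k * \<theta> k\<close> acts as an energy that loses one \<open>\<theta> k\<close> per
  step.\<close>

lemma distance_step:
  assumes min: "\<And>v. F z \<le> F v" and M: "norm (x (Suc (Suc k)) - z) \<le> M"
  defines "\<theta> \<equiv> \<lambda>k. max 0 ((norm (x (Suc k) - z))\<^sup>2 - (norm (x k - z))\<^sup>2)"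
  shows "T (Suc k) * \<theta> (Suc k) + \<theta> k \<le> T k * \<theta> k + (2 * (T k * (norm (x (Suc k) - x k))\<^sup>2)
    + 2 * \<tau> * ((T (Suc k))\<^sup>2 * \<epsilon> k) + 2 * M * (T (Suc k) * \<sigma> k))"
proof -
  define t where "t = T (Suc k)"
  have t: "t > 0" "t \<ge> 1" "T k \<le> t" "T k \<ge> 1" unfolding t_def using T_pos T_ge_1 T_mono by auto
  define \<alpha> where "\<alpha> = (T k - 1) / t"
  have \<alpha>: "\<alpha> \<ge> 0" "\<alpha> \<le> 1" "t * \<alpha> = T k - 1" unfolding \<alpha>_def using t by auto
  define \<phi> where "\<phi> j = (norm (x j - z))\<^sup>2" for j
  define D where "D = (norm (x (Suc k) - x k))\<^sup>2"
  define R where "R = 2 * (T k * D) + 2 * \<tau> * (t\<^sup>2 * \<epsilon> k) + 2 * M * (t * \<sigma> k)"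
  have M0: "M \<ge> 0" using M norm_ge_zero order_trans by blast
  have R: "R \<ge> 0"
    unfolding R_def D_def using t M0 \<tau>_pos \<epsilon>_nonneg \<sigma>_nonneg by (intro add_nonneg_nonneg mult_nonneg_nonneg) auto
  have "inner (x (Suc (Suc k)) - z) (e k) \<le> norm (x (Suc (Suc k)) - z) * norm (e k)"
    by (rule norm_cauchy_schwarz)
  also have "\<dots> \<le> M * \<sigma> k" using M M0 e_bound by (intro mult_mono) auto
  finally have I: "inner (x (Suc (Suc k)) - z) (e k) \<le> M * \<sigma> k" .
  have "\<phi> (Suc (Suc k)) / (2 * \<tau>) \<le> (norm (y k - z))\<^sup>2 / (2 * \<tau>) + \<epsilon> k + inner (x (Suc (Suc k)) - z) (e k) / \<tau>"
    using descent[of k z] min[of "x (Suc (Suc k))"] unfolding \<phi>_def by linarith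
  then have "\<phi> (Suc (Suc k)) \<le> (norm (y k - z))\<^sup>2 + 2 * \<tau> * \<epsilon> k + 2 * inner (x (Suc (Suc k)) - z) (e k)"
  proof -
    assume "\<phi> (Suc (Suc k)) / (2 * \<tau>)
      \<le> (norm (y k - z))\<^sup>2 / (2 * \<tau>) + \<epsilon> k + inner (x (Suc (Suc k)) - z) (e k) / \<tau>"
    then have "2 * \<tau> * (\<phi> (Suc (Suc k)) / (2 * \<tau>))
      \<le> 2 * \<tau> * ((norm (y k - z))\<^sup>2 / (2 * \<tau>) + \<epsilon> k + inner (x (Suc (Suc k)) - z) (e k) / \<tau>)"
      using \<tau>_pos by (intro mult_left_mono) auto
    then show ?thesis using \<tau>_pos by (simp add: distrib_left)
  qed
  also have "(norm (y k - z))\<^sup>2 = \<phi> (Suc k) + \<alpha> * (D + \<phi> (Suc k) - \<phi> k) + \<alpha>\<^sup>2 * D"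
  proof -
    have y: "y k - z = (x (Suc k) - z) + \<alpha> *\<^sub>R (x (Suc k) - x k)"
      unfolding y_eq \<alpha>_def t_def by simp
    have "D + \<phi> (Suc k) - \<phi> k = 2 * inner (x (Suc k) - x k) (x (Suc k) - z)"
      unfolding D_def \<phi>_def by (simp add: power2_norm_eq_inner inner_commute inner_diff_left inner_diff_right)
    then show ?thesis unfolding y norm_add_scaleR_squared by (simp add: \<phi>_def D_def)
  qed
  finally have "\<phi> (Suc (Suc k)) - \<phi> (Suc k)
      \<le> \<alpha> * (\<phi> (Suc k) - \<phi> k) + (\<alpha> + \<alpha>\<^sup>2) * D + 2 * \<tau> * \<epsilon> k + 2 * (M * \<sigma> k)"
    using I by (simp add: algebra_simps)
  then have "t * (\<phi> (Suc (Suc k)) - \<phi> (Suc k))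
      \<le> t * (\<alpha> * (\<phi> (Suc k) - \<phi> k) + (\<alpha> + \<alpha>\<^sup>2) * D + 2 * \<tau> * \<epsilon> k + 2 * (M * \<sigma> k))"
    using t by (intro mult_left_mono) auto
  also have "\<dots> = (T k - 1) * (\<phi> (Suc k) - \<phi> k) + (1 + \<alpha>) * (T k - 1) * D + 2 * \<tau> * (t * \<epsilon> k) + 2 * M * (t * \<sigma> k)"
    unfolding \<alpha>(3)[symmetric] by (simp add: algebra_simps power2_eq_square)
  also have "\<dots> \<le> (T k - 1) * \<theta> k + R"
  proof -
    have "(T k - 1) * (\<phi> (Suc k) - \<phi> k) \<le> (T k - 1) * \<theta> k"
      unfolding \<theta>_def \<phi>_def using t by (intro mult_left_mono) auto
    moreover have "(1 + \<alpha>) * (T k - 1) * D \<le> 2 * T k * D"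
      using \<alpha> t unfolding D_def by (intro mult_right_mono mult_mono) auto
    moreover have "2 * \<tau> * (t * \<epsilon> k) \<le> 2 * \<tau> * (t\<^sup>2 * \<epsilon> k)"
      using \<tau>_pos t \<epsilon>_nonneg by (intro mult_left_mono mult_right_mono) (auto simp: power2_eq_square)
    ultimately show ?thesis unfolding R_def by simp
  qed
  finally have "t * (\<phi> (Suc (Suc k)) - \<phi> (Suc k)) \<le> (T k - 1) * \<theta> k + R" .
  \<comment> \<open>Nonnegativity of the right-hand side allows passing from the increment to its
    positive part.\<close>
  moreover have "0 \<le> (T k - 1) * \<theta> k + R" using t R unfolding \<theta>_def by simp
  ultimately have "t * \<theta> (Suc k) \<le> (T k - 1) * \<theta> k + R"
    unfolding \<theta>_def \<phi>_def by (cases "(norm (x (Suc (Suc k)) - z))\<^sup>2 \<le> (norm (x (Suc k) - z))\<^sup>2") auto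
  then show ?thesis unfolding R_def D_def t_def by (simp add: left_diff_distrib)
qed

text \<open>Bounded iterates turn the error inner products into a summable perturbation, so
  \<open>perturbed_decrease\<close> with \<open>c = 0\<close> makes the positive increments \<theta>
  summable. The squared distance is then decreasing up to a summable error.\<close>

lemma distance_convergent:
  assumes min: "\<And>v. F z \<le> F v"
  shows "convergent (\<lambda>k. (norm (x k - z))\<^sup>2)"
proof -
  define \<theta> where "\<theta> k = max 0 ((norm (x (Suc k) - z))\<^sup>2 - (norm (x k - z))\<^sup>2)" for k
  obtain M where M: "\<And>k. norm (x (Suc k) - z) \<le> M"
  proof -
    from iterates_bounded[OF min] obtain K where "\<And>k. norm (x (Suc k)) \<le> K" by (auto simp: bounded_iff)
    then have "norm (x (Suc k) - z) \<le> K + norm z" for k using norm_triangle_le_diff[of "x (Suc k)" z] by (simp add: add_mono)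
    then show thesis by (rule that)
  qed
  then have M0: "M \<ge> 0" using norm_ge_zero order_trans by blast
  let ?b = "\<lambda>k. 2 * (T k * (norm (x (Suc k) - x k))\<^sup>2)
    + 2 * \<tau> * ((T (Suc k))\<^sup>2 * \<epsilon> k) + 2 * M * (T (Suc k) * \<sigma> k)"
  have "summable \<theta>"
  proof (rule perturbed_decrease(2))
    show "summable ?b"
      by (intro summable_add summable_mult summable_steps[OF min] \<epsilon>_summable \<sigma>_summable)
    show "T (Suc k) * \<theta> (Suc k) + \<theta> k \<le> T k * \<theta> k + ?b k + 0 * sqrt (T (Suc k) * \<theta> (Suc k))" for k
      using distance_step[OF min M, of k] unfolding \<theta>_def by simp
    show "T k * \<theta> k \<ge> 0" "\<theta> k \<ge> 0" for k unfolding \<theta>_def using T_nonneg by auto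
    show "?b k \<ge> 0" for k
      using T_nonneg M0 \<tau>_pos \<epsilon>_nonneg \<sigma>_nonneg by (intro add_nonneg_nonneg mult_nonneg_nonneg) auto
  qed auto
  then show ?thesis by (rule quasi_decreasing_convergent[rotated 2]) (auto simp: \<theta>_def)
qed

lemma iterates_converge: "\<exists>z. (\<forall>v. F z \<le> F v) \<and> x \<longlonglongrightarrow> z"
proof -
  obtain z where min: "\<And>v. F z \<le> F v"
    using continuous_bounded_sublevels_attains_min[OF F_continuous F_sublevel] by blast
  obtain l r where r: "strict_mono r" and l: "(\<lambda>k. x (Suc (r k))) \<longlonglongrightarrow> l"
    using bounded_imp_convergent_subsequence[OF iterates_bounded[OF min]] by (auto simp: o_def)
  have "norm (F (x (Suc k)) - F z) \<le> T (Suc k) * (F (x (Suc k)) - F z)" for k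
    using mult_right_mono[OF T_ge_1[of "Suc k"], of "F (x (Suc k)) - F z"] min by simp
  then have "summable (\<lambda>k. F (x (Suc k)) - F z)"
    by (intro summable_comparison_test[OF _ energy_bounds(2)[OF min]]) blast
  then have "(\<lambda>k. F (x (Suc k)) - F z) \<longlonglongrightarrow> 0" by (rule summable_LIMSEQ_zero)
  then have "(\<lambda>k. F (x (Suc (r k))) - F z) \<longlonglongrightarrow> 0"
    using LIMSEQ_subseq_LIMSEQ[OF _ r] by (fastforce simp: o_def)
  moreover have "(\<lambda>k. F (x (Suc (r k))) - F z) \<longlonglongrightarrow> F l - F z"
    using continuous_on_tendsto_compose[OF F_continuous l] by (intro tendsto_intros) auto
  ultimately have "F l = F z" using LIMSEQ_unique by fastforce
  \<comment> \<open>The cluster point \<open>l\<close> is itself a minimizer, so the distance to it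
    converges; the limit is 0 along the subsequence, hence along the whole sequence.\<close>
  then have minl: "\<And>v. F l \<le> F v" using min by simp
  then obtain L where L: "(\<lambda>k. (norm (x k - l))\<^sup>2) \<longlonglongrightarrow> L"
    using distance_convergent unfolding convergent_def by blast
  have "(\<lambda>k. (norm (x (Suc (r k)) - l))\<^sup>2) \<longlonglongrightarrow> L" (is "?f \<longlonglongrightarrow> _")
    using LIMSEQ_subseq_LIMSEQ[OF LIMSEQ_Suc[OF L] r] by (simp add: o_def)
  moreover have "?f \<longlonglongrightarrow> (norm (l - l))\<^sup>2"
    by (intro tendsto_intros l)
  ultimately have "L = (norm (l - l))\<^sup>2" by (rule LIMSEQ_unique)
  then have "L = 0" by simp
  then have "(\<lambda>k. norm (x k - l)) \<longlonglongrightarrow> 0"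
    using tendsto_real_sqrt[OF L] by simp
  then show ?thesis using minl LIM_zero_cancel tendsto_norm_zero_iff by blast
qed

end

section \<open>Weights, errors and extended-valued functions\<close>

text \<open>Mean value theorem: on points above 1 the derivative \<open>d * z powr (d - 1)\<close>
  is at most \<open>d\<close>, the exponent being nonpositive.\<close>

lemma powr_increment_le:
  fixes s h d :: real
  assumes "1 \<le> s" "0 \<le> h" "0 < d" "d \<le> 1"
  shows "(s + h) powr d - s powr d \<le> d * h"
proof (cases "h = 0")
  case False
  then have "s < s + h" using assms by simp
  then obtain z where z: "s < z" "z < s + h"
    and eq: "(s + h) powr d - s powr d = (s + h - s) * (d * z powr (d - 1))"
    by (rule MVT2[of s "s + h" "\<lambda>z. z powr d" "\<lambda>z. d * z powr (d - 1)", THEN exE])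
      (use assms in \<open>auto intro!: derivative_eq_intros simp: powr_diff\<close>)
  have "z powr (d - 1) \<le> z powr 0" using z assms by (intro powr_mono) auto
  then have "h * (d * z powr (d - 1)) \<le> h * (d * 1)"
    using z assms by (intro mult_left_mono) auto
  then show ?thesis using eq by (simp add: mult_ac)
qed simp

text \<open>Makes the margin \<open>1 - 2 * d / a\<close> of the growth condition positive. If
  \<open>2 * d > 1\<close>, raising it to the power \<open>1 / d\<close>, which is at least 1, does
  not decrease it; otherwise \<open>a > 1\<close> suffices.\<close>

lemma less_of_powr_less:
  fixes a d :: real
  assumes "0 < d" "d \<le> 1" "a > max 1 ((2 * d) powr (1 / d))"
  shows "2 * d < a"
proof (cases "2 * d \<le> 1")
  case False
  then have "(2 * d) powr 1 \<le> (2 * d) powr (1 / d)" using assms by (intro powr_mono) auto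
  then show ?thesis using assms by simp
qed (use assms in auto)

text \<open>For \<open>d \<le> 1\<close> the increments of \<open>t\<close> are at most \<open>d / a\<close>.\<close>

lemma fista_weights_growth:
  fixes a d :: real and t :: "nat \<Rightarrow> real"
  assumes t: "\<And>k. t (Suc k) = ((real k + a) / a) powr d"
    and params: "0 < d" "d \<le> 1" "a > 0"
  shows "(t (Suc (Suc k)))\<^sup>2 - t (Suc (Suc k)) + (1 - 2 * d / a) * t (Suc (Suc k)) \<le> (t (Suc k))\<^sup>2"
    and "t (Suc k) \<le> t (Suc (Suc k))" and "1 \<le> t (Suc k)"
proof -
  let ?s = "(real k + a) / a"
  have s: "1 \<le> ?s" "(real (Suc k) + a) / a = ?s + 1 / a" using params by (simp_all add: field_simps)
  have inc: "t (Suc (Suc k)) - t (Suc k) \<le> d / a"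
    using powr_increment_le[of ?s "1 / a" d] s params unfolding t by simp
  show mono: "t (Suc k) \<le> t (Suc (Suc k))"
    unfolding t using params by (intro powr_mono2) (auto simp: divide_right_mono)
  show ge: "1 \<le> t (Suc k)" unfolding t using s params by (intro ge_one_powr_ge_zero) auto
  have "(t (Suc (Suc k)))\<^sup>2 - (t (Suc k))\<^sup>2 = (t (Suc (Suc k)) - t (Suc k)) * (t (Suc (Suc k)) + t (Suc k))"
    by (simp add: power2_eq_square algebra_simps)
  \<comment> \<open>The increment costs \<open>d / a\<close> and monotonicity bounds the sum by
    twice the new weight; what remains of the linear term is the margin
    \<open>1 - 2 * d / a\<close>.\<close>
  also have "\<dots> \<le> d / a * (2 * t (Suc (Suc k)))"
    using inc mono ge params by (intro mult_mono) auto
  finally show "(t (Suc (Suc k)))\<^sup>2 - t (Suc (Suc k)) + (1 - 2 * d / a) * t (Suc (Suc k)) \<le> (t (Suc k))\<^sup>2"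
    by (simp add: algebra_simps)
qed

text \<open>The Type 1 error condition implies the Type 2 one: summable terms are eventually below
  1, where they dominate their squares.\<close>

lemma summable_powr_mult_of_sqrt:
  fixes \<epsilon> :: "nat \<Rightarrow> real"
  assumes "summable (\<lambda>k. real (Suc k) powr d * sqrt (\<epsilon> k))" "\<And>k. \<epsilon> k \<ge> 0"
  shows "summable (\<lambda>k. real (Suc k) powr (2 * d) * \<epsilon> k)"
proof -
  let ?q = "\<lambda>k. real (Suc k) powr d * sqrt (\<epsilon> k)"
  have "summable (\<lambda>k. ?q k * ?q k)"
  proof (rule summable_comparison_test_ev[OF _ assms(1)])
    have "?q \<longlonglongrightarrow> 0" using assms(1) by (rule summable_LIMSEQ_zero)
    then have "\<forall>\<^sub>F k in sequentially. ?q k < 1" by (rule order_tendstoD) simp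
    then show "\<forall>\<^sub>F k in sequentially. norm (?q k * ?q k) \<le> ?q k"
      by eventually_elim (use assms(2) in \<open>simp add: mult_left_le\<close>)
  qed
  moreover have "?q k * ?q k = real (Suc k) powr (2 * d) * \<epsilon> k" for k
    using assms(2)[of k] by (simp add: mult_ac powr_add[symmetric] flip: mult.assoc)
  ultimately show ?thesis by simp
qed

lemma smoothed_convex_approx_finite:
  assumes "smoothed_convex_approx R \<gamma> R\<gamma>" "proper_fun R"
  shows "\<bar>R v\<bar> \<noteq> \<infinity>"
proof -
  obtain \<eta> where "R v - ereal (\<eta> * \<gamma>) \<le> ereal (R\<gamma> v)"
    using assms(1) unfolding smoothed_convex_approx_def by blast
  then have "R v \<noteq> \<infinity>" by auto
  then show ?thesis using assms(2) unfolding proper_fun_def by (simp add: ereal_infinity_cases)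
qed

lemma convex_fun_ereal:
  assumes "convex_fun (\<lambda>v. ereal (g v))"
  shows "convex_on UNIV g"
proof (intro convex_onI)
  fix l :: real and v w assume "0 < l" "l < 1"
  then show "g ((1 - l) *\<^sub>R v + l *\<^sub>R w) \<le> (1 - l) * g v + l * g w"
    using assms[unfolded convex_fun_def, rule_format, of "1 - l" l v w] by simp
qed simp

lemma coercive_fun_sublevel_bounded:
  fixes F :: "'a::real_normed_vector \<Rightarrow> real"
  assumes "coercive_fun (\<lambda>v. ereal (F v))"
  shows "bounded {v. F v \<le> B}"
proof -
  have "\<forall>\<^sub>F v in at_infinity. ereal B < ereal (F v)"
    using assms unfolding coercive_fun_def by (rule order_tendstoD) simp
  then obtain b where "\<And>v. b \<le> norm v \<Longrightarrow> B < F v" unfolding eventually_at_infinity by auto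
  then have "norm v \<le> b" if "F v \<le> B" for v using that by (meson linear not_less)
  then show ?thesis by (auto intro: boundedI)
qed

text \<open>A common form for both types. Type 2 already is an \<epsilon>-subgradient condition and
  takes \<open>e = 0\<close>.\<close>

lemma prox_approx_subgradient:
  fixes g :: "'a::euclidean_space \<Rightarrow> real"
  assumes "prox_approx i \<epsilon> \<tau> (\<lambda>v. ereal (g v)) w x" and g: "convex_on UNIV g" and \<tau>: "\<tau> > 0"
    and "\<epsilon> \<ge> 0"
  shows "\<exists>e. norm e \<le> (if i = Type1 then sqrt (2 * \<tau> * \<epsilon>) else 0)
    \<and> (\<forall>z. g x + inner (z - x) (w - x + e) / \<tau> - \<epsilon> \<le> g z)"
proof (cases i)
  case Type1
  then have "g x + (norm (x - w))\<^sup>2 / (2 * \<tau>) \<le> g z + (norm (z - w))\<^sup>2 / (2 * \<tau>) + \<epsilon>" for z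
    using assms(1) by (auto simp: eps_subdiff_def algebra_simps)
  from Type1_prox_subgradient[OF g \<tau> this] show ?thesis using Type1 by auto
next
  case Type2
  then have "g x + inner (z - x) (w - x + 0) / \<tau> - \<epsilon> \<le> g z" for z
    using assms(1) by (auto simp: eps_subdiff_def divide_inverse mult.commute)
  then show ?thesis using Type2 by (intro exI[of _ 0]) auto
qed

section \<open>From the multilevel iteration to inexact FISTA\<close>

theorem theorem2p16:
  fixes L\<^sub>h R\<^sub>h\<gamma> :: "real ^ 'n \<Rightarrow> real" and R\<^sub>h :: "real ^ 'n \<Rightarrow> ereal"
    and L\<^sub>H R\<^sub>H\<gamma> :: "real ^ 'm \<Rightarrow> real" and R\<^sub>H :: "real ^ 'm \<Rightarrow> ereal"
    and F\<^sub>h :: "real ^ 'n \<Rightarrow> ereal" and F\<^sub>H :: "nat \<Rightarrow> real ^ 'm \<Rightarrow> real"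
    and IhH :: "real ^ 'n \<Rightarrow> real ^ 'm" and IHh :: "real ^ 'm \<Rightarrow> real ^ 'n"
    and \<beta>\<^sub>h \<beta>\<^sub>H \<tau>\<^sub>h \<tau>\<^sub>H \<gamma>\<^sub>h \<gamma>\<^sub>H \<nu> a d :: real
    and m p :: nat
    and \<Phi> :: "real \<Rightarrow> nat \<Rightarrow> nat \<Rightarrow> real ^ 'm \<Rightarrow> real ^ 'm"
    and s\<^sub>0 s\<^sub>m :: "nat \<Rightarrow> real ^ 'm"
    and C :: "nat set"
    and i :: approx_type
    and \<epsilon> \<tau>bar t \<alpha> :: "nat \<Rightarrow> real"
    and x y ybar :: "nat \<Rightarrow> real ^ 'n"
  assumes dims: "CARD('m) < CARD('n)"
    \<comment> \<open>fine level\<close>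
    and L\<^sub>h: "convex_on UNIV L\<^sub>h" "\<And>z. L\<^sub>h differentiable (at z)"
    and R\<^sub>h: "convex_fun R\<^sub>h" "lsc_fun R\<^sub>h" "proper_fun R\<^sub>h"
    and F\<^sub>h: "F\<^sub>h = (\<lambda>z. ereal (L\<^sub>h z) + R\<^sub>h z)" "coercive_fun F\<^sub>h"
    \<comment> \<open>coarse level\<close>
    and L\<^sub>H: "convex_on UNIV L\<^sub>H" "\<And>z. L\<^sub>H differentiable (at z)"
    and R\<^sub>H: "convex_fun R\<^sub>H" "lsc_fun R\<^sub>H" "proper_fun R\<^sub>H"
    and transfer: "linear IhH" "\<nu> > 0" "IHh = (\<lambda>z. \<nu> *\<^sub>R adjoint IhH z)"
    and smoothing: "\<gamma>\<^sub>h > 0" "smoothed_convex_approx R\<^sub>h \<gamma>\<^sub>h R\<^sub>h\<gamma>"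
      "\<gamma>\<^sub>H > 0" "smoothed_convex_approx R\<^sub>H \<gamma>\<^sub>H R\<^sub>H\<gamma>"
    and coarse_model: "\<And>k. F\<^sub>H k = coarse_model IhH L\<^sub>h R\<^sub>h\<gamma> L\<^sub>H R\<^sub>H\<gamma> (y k)"
    and coarse_iterates: "m > 0" "\<And>k. s\<^sub>0 k = IhH (y k)"
      "\<And>k. s\<^sub>m k = fold (\<Phi> \<tau>\<^sub>H k) [0..<m] (s\<^sub>0 k)"
    and coarse_decrease: "\<And>k. F\<^sub>H k (s\<^sub>m k) \<le> F\<^sub>H k (s\<^sub>0 k)"
    and coarse_bounded: "bounded (range (\<lambda>k. s\<^sub>m k - s\<^sub>0 k))"
    \<comment> \<open>the iteration; \<open>C\<close> is the set of indices at which a coarse correction is computed\<close>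
    and correction_step: "\<And>k. k \<in> C \<Longrightarrow> \<tau>bar k > 0"
    and ybar_step: "\<And>k. ybar k = (if k \<in> C then y k + \<tau>bar k *\<^sub>R IHh (s\<^sub>m k - s\<^sub>0 k) else y k)"
    and eps_nonneg: "\<And>k. \<epsilon> k \<ge> 0"
    and x_step: "\<And>k. prox_approx i (\<epsilon> k) \<tau>\<^sub>h R\<^sub>h (ybar k - \<tau>\<^sub>h *\<^sub>R gradient L\<^sub>h (ybar k)) (x (Suc k))"
    and \<alpha>: "\<And>k. \<alpha> k = (t k - 1) / t (Suc k)"
    and y_step: "\<And>k. y (Suc k) = x (Suc k) + \<alpha> k *\<^sub>R (x (Suc k) - x k)"
    \<comment> \<open>(1)\<close>
    and t: "t 0 = 1" "\<And>k. t (Suc k) = ((real k + a) / a) powr d"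
    and params: "0 < d" "d \<le> 1" "a > max 1 ((2 * d) powr (1 / d))"
    \<comment> \<open>(2)\<close>
    and lipschitz: "\<beta>\<^sub>h-lipschitz_on UNIV (gradient L\<^sub>h)" "\<beta>\<^sub>H-lipschitz_on UNIV (gradient L\<^sub>H)"
      "\<beta>\<^sub>h > 0" "\<beta>\<^sub>H > 0"
    and corrections: "finite C" "card C \<le> p"
    and steps: "\<tau>\<^sub>h > 0" "\<tau>\<^sub>h < inverse \<beta>\<^sub>h" "\<tau>\<^sub>H > 0" "\<tau>\<^sub>H < inverse \<beta>\<^sub>H"
    \<comment> \<open>(3)\<close>
    and errors1: "i = Type1 \<Longrightarrow> summable (\<lambda>k. real (Suc k) powr d * sqrt (\<epsilon> (Suc k)))"
    and errors2: "i = Type2 \<Longrightarrow> summable (\<lambda>k. real (Suc k) powr (2 * d) * \<epsilon> (Suc k))"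
  shows "(\<forall>xstar. is_arg_min F\<^sub>h (\<lambda>_. True) xstar \<longrightarrow>
            in_ell_infinity (\<lambda>k. ereal (real k powr (2 * d)) * (F\<^sub>h (x k) - F\<^sub>h xstar)))
       \<and> (\<exists>xstar. is_arg_min F\<^sub>h (\<lambda>_. True) xstar \<and> x \<longlonglongrightarrow> xstar)"
proof -
  have "0 < \<tau>\<^sub>h" and "\<beta>\<^sub>h \<le> inverse \<tau>\<^sub>h"
    using steps(1,2) lipschitz(3) by (simp_all add: field_simps)
  have a: "a > 1" "a > 0" using params(3) by auto
  define g where "g v = real_of_ereal (R\<^sub>h v)" for v
  have R: "R\<^sub>h = (\<lambda>v. ereal (g v))"
    unfolding g_def using smoothed_convex_approx_finite[OF smoothing(2) R\<^sub>h(3)] by (simp add: ereal_real')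
  define F where "F v = L\<^sub>h v + g v" for v
  have F: "F\<^sub>h = (\<lambda>v. ereal (F v))" unfolding F\<^sub>h(1) R F_def by simp
  have g_convex: "convex_on UNIV g" using R\<^sub>h(1) unfolding R by (rule convex_fun_ereal)
  have F_sublevel: "bounded {v. F v \<le> B}" for B
    using F\<^sub>h(2) unfolding F by (rule coercive_fun_sublevel_bounded)
  have arg_min: "is_arg_min F\<^sub>h (\<lambda>_. True) z \<longleftrightarrow> (\<forall>v. F z \<le> F v)" for z
    unfolding is_arg_min_linorder F by simp
  define \<delta> where "\<delta> k = (if i = Type1 then sqrt (2 * \<tau>\<^sub>h * \<epsilon> k) else 0)" for k
  have "\<exists>e. norm e \<le> \<delta> k \<and> (\<forall>z. F (x (Suc k)) + (norm (x (Suc k) - z))\<^sup>2 / (2 * \<tau>\<^sub>h)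
      \<le> F z + (norm (ybar k - z))\<^sup>2 / (2 * \<tau>\<^sub>h) + \<epsilon> k + inner (x (Suc k) - z) e / \<tau>\<^sub>h)" for k
  proof -
    from prox_approx_subgradient[OF x_step[of k, unfolded R] g_convex steps(1) eps_nonneg]
    obtain e where e: "norm e \<le> \<delta> k"
      and sub: "\<And>z. g (x (Suc k)) + inner (z - x (Suc k))
        (ybar k - \<tau>\<^sub>h *\<^sub>R gradient L\<^sub>h (ybar k) - x (Suc k) + e) / \<tau>\<^sub>h - \<epsilon> k \<le> g z"
      unfolding \<delta>_def by blast
    show ?thesis
      using forward_backward_descent[OF L\<^sub>h lipschitz(1) \<open>0 < \<tau>\<^sub>h\<close> \<open>\<beta>\<^sub>h \<le> inverse \<tau>\<^sub>h\<close> sub] e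
      unfolding F_def by blast
  qed
  then obtain e where e: "\<And>k. norm (e k) \<le> \<delta> k"
    and desc: "\<And>k z. F (x (Suc k)) + (norm (x (Suc k) - z))\<^sup>2 / (2 * \<tau>\<^sub>h)
      \<le> F z + (norm (ybar k - z))\<^sup>2 / (2 * \<tau>\<^sub>h) + \<epsilon> k + inner (x (Suc k) - z) (e k) / \<tau>\<^sub>h"
    by metis
  obtain N where N: "\<And>k. k \<in> C \<Longrightarrow> k \<le> N"
    using corrections(1) by (auto simp: finite_nat_set_iff_bounded_le)
  \<comment> \<open>Beyond the last correction index the proximal step starts from the extrapolated
    point itself.\<close>
  have ybar: "ybar (Suc (k + N)) = y (Suc (k + N))" for k
    using ybar_step[of "Suc (k + N)"] N[of "Suc (k + N)"] by auto
  \<comment> \<open>Since \<open>a > 1\<close>, the weight is at most the corresponding power of the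
    index, so the assumed error sums control those weighted by \<open>t\<close>.\<close>
  have t_le: "t (Suc k) \<le> real (Suc k) powr d" for k
    unfolding t(2) using a params mult_right_mono[of 1 a "real k"]
    by (intro powr_mono2) (auto simp: field_simps)
  note t_facts = fista_weights_growth[OF t(2) params(1,2) a(2)]
  have t_nonneg: "t (Suc k) \<ge> 0" for k using t_facts(3)[of k] by simp
  have summable_eps: "summable (\<lambda>k. (t (Suc k))\<^sup>2 * \<epsilon> (Suc k))"
    if "summable (\<lambda>k. real (Suc k) powr (2 * d) * \<epsilon> (Suc k))"
  proof (rule summable_comparison_test[OF _ that], intro exI allI impI)
    fix k
    have "(t (Suc k))\<^sup>2 \<le> (real (Suc k) powr d)\<^sup>2" using t_le t_nonneg by (intro power_mono)
    also have "\<dots> = real (Suc k) powr (2 * d)" by (simp add: power2_eq_square flip: powr_add)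
    finally show "norm ((t (Suc k))\<^sup>2 * \<epsilon> (Suc k)) \<le> real (Suc k) powr (2 * d) * \<epsilon> (Suc k)"
      using eps_nonneg by (simp add: mult_right_mono)
  qed
  have sums: "summable (\<lambda>k. (t (Suc k))\<^sup>2 * \<epsilon> (Suc k)) \<and> summable (\<lambda>k. t (Suc k) * \<delta> (Suc k))"
  proof (cases i)
    case Type1
    have "summable (\<lambda>k. sqrt (2 * \<tau>\<^sub>h) * (real (Suc k) powr d * sqrt (\<epsilon> (Suc k))))"
      by (intro summable_mult errors1 Type1)
    then have "summable (\<lambda>k. t (Suc k) * \<delta> (Suc k))"
    proof (rule summable_comparison_test[rotated], intro exI allI impI)
      fix k
      have "t (Suc k) * sqrt (\<epsilon> (Suc k)) \<le> real (Suc k) powr d * sqrt (\<epsilon> (Suc k))"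
        using t_le eps_nonneg by (intro mult_right_mono) auto
      then have "sqrt (2 * \<tau>\<^sub>h) * (t (Suc k) * sqrt (\<epsilon> (Suc k)))
          \<le> sqrt (2 * \<tau>\<^sub>h) * (real (Suc k) powr d * sqrt (\<epsilon> (Suc k)))"
        using steps(1) by (intro mult_left_mono) auto
      moreover have "t (Suc k) * \<delta> (Suc k) = sqrt (2 * \<tau>\<^sub>h) * (t (Suc k) * sqrt (\<epsilon> (Suc k)))"
        unfolding \<delta>_def using Type1 by (simp add: real_sqrt_mult)
      moreover have "t (Suc k) * \<delta> (Suc k) \<ge> 0"
        using t_nonneg[of k] e[of "Suc k"] order_trans[OF norm_ge_zero] by (intro mult_nonneg_nonneg) blast+
      ultimately show "norm (t (Suc k) * \<delta> (Suc k))
          \<le> sqrt (2 * \<tau>\<^sub>h) * (real (Suc k) powr d * sqrt (\<epsilon> (Suc k)))"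
        unfolding real_norm_def by linarith
    qed
    then show ?thesis
      using summable_eps summable_powr_mult_of_sqrt[OF errors1[OF Type1] eps_nonneg] by blast
  next
    case Type2
    then show ?thesis using summable_eps[OF errors2] by (simp add: \<delta>_def)
  qed
  \<comment> \<open>Starting at \<open>Suc N\<close> does two things: the weights have positive
    index, where the power formula applies, and all extrapolated points
    \<open>y (Suc (k + M))\<close> come after the last correction.\<close>
  define M where "M = Suc N"
  interpret inexact_fista F "\<lambda>k. x (k + M)" "\<lambda>k. y (Suc (k + M))" "\<lambda>k. e (Suc (k + M))"
    "\<lambda>k. t (k + M)" "\<lambda>k. \<epsilon> (Suc (k + M))" "\<lambda>k. \<delta> (Suc (k + M))" \<tau>\<^sub>h "1 - 2 * d / a"
  proof
    show "0 < \<tau>\<^sub>h" by (rule steps(1))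
    show "convex_on UNIV F" unfolding F_def by (intro convex_on_add L\<^sub>h(1) g_convex)
    show "bounded {v. F v \<le> B}" for B by (rule F_sublevel)
    show "1 \<le> t (k + M)" "t (k + M) \<le> t (Suc k + M)" for k
      using t_facts(2,3)[of "k + N"] by (simp_all add: M_def)
    show "0 < 1 - 2 * d / a" using less_of_powr_less[OF params] a by simp
    show "(t (Suc k + M))\<^sup>2 - t (Suc k + M) + (1 - 2 * d / a) * t (Suc k + M) \<le> (t (k + M))\<^sup>2" for k
      using t_facts(1)[of "k + N"] by (simp add: M_def)
    show "y (Suc (k + M)) = x (Suc k + M) + ((t (k + M) - 1) / t (Suc k + M)) *\<^sub>R (x (Suc k + M) - x (k + M))" for k
      using y_step[of "k + M"] \<alpha>[of "k + M"] by simp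
    show "F (x (Suc (Suc k) + M)) + (norm (x (Suc (Suc k) + M) - v))\<^sup>2 / (2 * \<tau>\<^sub>h)
      \<le> F v + (norm (y (Suc (k + M)) - v))\<^sup>2 / (2 * \<tau>\<^sub>h) + \<epsilon> (Suc (k + M))
        + inner (x (Suc (Suc k) + M) - v) (e (Suc (k + M))) / \<tau>\<^sub>h" for k v
      using desc[of "Suc (k + M)" v] ybar[of "Suc k"] by (simp add: M_def)
    show "0 \<le> \<epsilon> (Suc (k + M))" "norm (e (Suc (k + M))) \<le> \<delta> (Suc (k + M))" for k
      by (rule eps_nonneg e)+
    show "summable (\<lambda>k. (t (Suc k + M))\<^sup>2 * \<epsilon> (Suc (k + M)))"
      using summable_ignore_initial_segment[OF conjunct1[OF sums], of M] by simp
    show "summable (\<lambda>k. t (Suc k + M) * \<delta> (Suc (k + M)))"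
      using summable_ignore_initial_segment[OF conjunct2[OF sums], of M] by simp
  qed
  have rate: "in_ell_infinity (\<lambda>k. ereal (real k powr (2 * d)) * (F\<^sub>h (x k) - F\<^sub>h z))"
    if "is_arg_min F\<^sub>h (\<lambda>_. True) z" for z
  proof -
    from that have min: "\<And>v. F z \<le> F v" unfolding arg_min by blast
    obtain B where B: "\<And>k. (t (k + M))\<^sup>2 * (F (x (Suc k + M)) - F z) \<le> B"
      using objective_rate[OF min] by blast
    let ?q = "\<lambda>k. real k powr (2 * d) * (F (x k) - F z)"
    have "norm (?q (k + Suc M)) \<le> (2 * a) powr (2 * d) * B" for k
    proof -
      \<comment> \<open>The factor \<open>2 * a\<close> comes from
        \<open>k + N + 2 <= 2 * (k + N + a)\<close>, valid because \<open>a > 1\<close>.\<close>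
      have "real (k + Suc M) powr (2 * d) \<le> (2 * a * ((real (k + N) + a) / a)) powr (2 * d)"
        using a params by (intro powr_mono2) (auto simp: M_def)
      also have "\<dots> = (2 * a) powr (2 * d) * ((real (k + N) + a) / a) powr (2 * d)"
        by (rule powr_mult)
      also have "((real (k + N) + a) / a) powr (2 * d) = (t (k + M))\<^sup>2"
        using t(2)[of "k + N"] by (simp add: M_def power2_eq_square flip: powr_add)
      finally have "?q (k + Suc M) \<le> (2 * a) powr (2 * d) * (t (k + M))\<^sup>2 * (F (x (Suc k + M)) - F z)"
        using min[of "x (Suc k + M)"] by (simp add: mult_right_mono)
      also have "\<dots> \<le> (2 * a) powr (2 * d) * B"
        unfolding mult.assoc by (intro mult_left_mono B) simp
      finally show ?thesis using min by simp
    qed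
    then have "Bseq (\<lambda>k. ?q (k + Suc M))" by (rule BseqI')
    \<comment> \<open>The finitely many earlier terms, including those affected by corrections, are
      real numbers because \<open>F\<close> is finite everywhere.\<close>
    then have "Bseq ?q" by (rule Bseq_offset)
    then obtain K where "\<And>k. norm (?q k) \<le> K" unfolding Bseq_def by blast
    then show ?thesis
      unfolding in_ell_infinity_def F by (intro exI[of _ K]) (simp add: abs_mult)
  qed
  from iterates_converge obtain z where "\<forall>v. F z \<le> F v" "(\<lambda>k. x (k + M)) \<longlonglongrightarrow> z" by blast
  then have "is_arg_min F\<^sub>h (\<lambda>_. True) z" "x \<longlonglongrightarrow> z"
    unfolding arg_min by (auto dest: LIMSEQ_offset)
  then show ?thesis using rate by blast
qed

end
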